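(* Let $U\subseteq\mathbb R^2$ be a nonempty connected open set with coordinates $(x,u)$, let $\phi\in\mathcal C^\infty(U)$, and consider the first-order ODE $u'(x)=\phi(x,u)$, with associated vector field $A=\partial_x+\phi\,\partial_u$ and associated surface $\mathcal S=(U,g)$. Suppose that the Gaussian curvature of $\mathcal S$ is constant, $\mathcal K=k\in\mathbb R$. For $c_1,c_2\in\mathbb R$ not both zero, let $$\delta(x)=\begin{cases} c_1\cos(\sqrt{k}\,x)+c_2\sin(\sqrt{k}\,x), & k>0,\\ c_1+c_2x, & k=0,\\ c_1\cosh(\sqrt{-k}\,x)+c_2\sinh(\sqrt{-k}\,x), & k<0.\end{cases}$$ Then $J=\delta(x)\,\partial_u$ is a non-trivial Jacobi field relative to $A$. Consequently, with $\mathfrak S(\delta)=A(\delta)-\phi_u\delta$: if $\mathfrak S(\delta)=0$ on $U$, then every point at which $\delta\ne0$ has an open neighbourhood on which $\delta^{-1}$ is an integrating factor for $-\phi\,dx+du\equiv0$; and if $\mathfrak S(\delta)$ is not identically zero on $U$, then every point at which $\mathfrak S(\delta)\neq0$ has an open neighbourhood on which $\mathfrak S(\delta)$ is an integrating factor for $-\phi\,dx+du\equiv0$.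
   Context: Subscripts denote partial derivatives, and vector fields act on functions as derivations. Integrating factor: on an open set $V\subseteq U$, a non-vanishing $\mu\in\mathcal C^\infty(V)$ is an integrating factor for $-\phi\,dx+du\equiv0$ if there exists $F\in\mathcal C^\infty(V)$ with $dF=\mu(-\phi\,dx+du)$. Associated surface: $\mathcal S=(U,g)$, where $g$ is the Riemannian metric whose matrix in the coordinates $(x,u)$ is $\begin{pmatrix}1+\phi^2&-\phi\\-\phi&1\end{pmatrix}$. The vector fields $A$ and $\partial_u$ form an orthonormal frame for $g$. Let $\nabla$ be the Levi-Civita connection of $g$. For $X=x_1A+x_2\partial_u$ and $Y=y_1A+y_2\partial_u$ it is given by $\nabla_XY=(X(y_1)-\phi_u x_2y_2)A+(X(y_2)+\phi_u x_2y_1)\partial_u$. The vector field $A$ is geodesic, i.e. $\nabla_AA=0$. The Gaussian curvature of $\mathcal S$ is $\mathcal K=-\partial_u(A(\phi))$. Jacobi field relative to $A$: a smooth vector field $J$ on $U$ such that $\nabla_A\nabla_AJ+\mathcal K\,(g(A,A)J-g(J,A)A)=0$, where $g(A,A)=1$. The fields $J=(ax+b)A$ with $a,b\in\mathbb R$ are Jacobi fields relative to $A$, called trivial; every other Jacobi field relative to $A$ is called non-trivial. *)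

theory Defs
  imports "HOL-Analysis.Analysis"
begin

section \<open>Smooth functions and vector fields on open subsets of Euclidean space\<close>

text \<open>Vector fields are given by their components in the coordinate frame. All notions below
  are only meaningful at points of an open set on which the data are smooth.\<close>

primrec Ck_on :: "nat \<Rightarrow> (real^'n) set \<Rightarrow> (real^'n \<Rightarrow> 'b::real_normed_vector) \<Rightarrow> bool" where
  "Ck_on 0 S f \<longleftrightarrow> continuous_on S f"
| "Ck_on (Suc m) S f \<longleftrightarrow>
     (\<forall>p\<in>S. f differentiable (at p)) \<and> (\<forall>v. Ck_on m S (\<lambda>p. frechet_derivative f (at p) v))"

definition smooth_on :: "(real^'n) set \<Rightarrow> (real^'n \<Rightarrow> 'b::real_normed_vector) \<Rightarrow> bool" where
  "smooth_on S f \<longleftrightarrow> (\<forall>m. Ck_on m S f)"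

text \<open>The derivation \<open>X(f)\<close>, applied componentwise if \<open>f\<close> is vector-valued.\<close>

definition vf_deriv ::
    "(real^'n \<Rightarrow> real^'n) \<Rightarrow> (real^'n \<Rightarrow> 'b::real_normed_vector) \<Rightarrow> real^'n \<Rightarrow> 'b" where
  "vf_deriv X f p = frechet_derivative f (at p) (X p)"

definition coord_field :: "'n \<Rightarrow> real^'n \<Rightarrow> real^'n" where
  "coord_field i p = axis i 1"

definition partial :: "'n \<Rightarrow> (real^'n \<Rightarrow> 'b::real_normed_vector) \<Rightarrow> real^'n \<Rightarrow> 'b" where
  "partial i f = vf_deriv (coord_field i) f"

definition lie_bracket ::
    "(real^'n \<Rightarrow> real^'n) \<Rightarrow> (real^'n \<Rightarrow> real^'n) \<Rightarrow> real^'n \<Rightarrow> real^'n" where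
  "lie_bracket X Y p = vf_deriv X Y p - vf_deriv Y X p"

section \<open>Levi-Civita connection and curvature of a metric given by its matrix\<close>

definition metric_at :: "(real^'n \<Rightarrow> real^'n^'n) \<Rightarrow> real^'n \<Rightarrow> real^'n \<Rightarrow> real^'n \<Rightarrow> real" where
  "metric_at G p v w = v \<bullet> (G p *v w)"

definition christoffel :: "(real^'n \<Rightarrow> real^'n^'n) \<Rightarrow> 'n \<Rightarrow> 'n \<Rightarrow> 'n \<Rightarrow> real^'n \<Rightarrow> real" where
  "christoffel G k i j p =
     (1/2) * (\<Sum>l\<in>UNIV. matrix_inv (G p) $ k $ l *
       (partial i (\<lambda>q. G q $ j $ l) p + partial j (\<lambda>q. G q $ i $ l) p
         - partial l (\<lambda>q. G q $ i $ j) p))"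

definition levi_civita ::
    "(real^'n \<Rightarrow> real^'n^'n) \<Rightarrow> (real^'n \<Rightarrow> real^'n) \<Rightarrow> (real^'n \<Rightarrow> real^'n) \<Rightarrow> real^'n \<Rightarrow> real^'n"
  where
  "levi_civita G X Y p =
     (\<chi> k. vf_deriv X (\<lambda>q. Y q $ k) p
        + (\<Sum>i\<in>UNIV. \<Sum>j\<in>UNIV. christoffel G k i j p * X p $ i * Y p $ j))"

definition riemann_curvature ::
    "(real^'n \<Rightarrow> real^'n^'n) \<Rightarrow> (real^'n \<Rightarrow> real^'n) \<Rightarrow> (real^'n \<Rightarrow> real^'n) \<Rightarrow>
     (real^'n \<Rightarrow> real^'n) \<Rightarrow> real^'n \<Rightarrow> real^'n" where
  "riemann_curvature G X Y Z p =
     levi_civita G X (levi_civita G Y Z) p - levi_civita G Y (levi_civita G X Z) p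
       - levi_civita G (lie_bracket X Y) Z p"

text \<open>The sign conventions make the round sphere positively curved.\<close>

definition gaussian_curvature :: "(real^2 \<Rightarrow> real^2^2) \<Rightarrow> real^2 \<Rightarrow> real" where
  "gaussian_curvature G p =
     metric_at G p
       (riemann_curvature G (coord_field 1) (coord_field 2) (coord_field 2) p) (coord_field 1 p)
     / det (G p)"

definition jacobi_field ::
    "(real^2) set \<Rightarrow> (real^2 \<Rightarrow> real^2^2) \<Rightarrow> (real^2 \<Rightarrow> real^2) \<Rightarrow> (real^2 \<Rightarrow> real^2) \<Rightarrow> bool" where
  "jacobi_field U G A J \<longleftrightarrow> smooth_on U J \<and>
     (\<forall>p\<in>U. levi_civita G A (levi_civita G A J) p
        + gaussian_curvature G p *\<^sub>R
            (metric_at G p (A p) (A p) *\<^sub>R J p - metric_at G p (J p) (A p) *\<^sub>R A p) = 0)"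

section \<open>The surface associated with the equation \<open>u' = \<phi>(x,u)\<close>\<close>

text \<open>A point \<open>p\<close> has coordinates \<open>x = p $ 1\<close> and \<open>u = p $ 2\<close>.\<close>

definition ode_field :: "(real^2 \<Rightarrow> real) \<Rightarrow> real^2 \<Rightarrow> real^2" where
  "ode_field \<phi> p = coord_field 1 p + \<phi> p *\<^sub>R coord_field 2 p"

definition ode_metric :: "(real^2 \<Rightarrow> real) \<Rightarrow> real^2 \<Rightarrow> real^2^2" where
  "ode_metric \<phi> p = vector [vector [1 + (\<phi> p)\<^sup>2, - \<phi> p], vector [- \<phi> p, 1]]"

definition trivial_on :: "(real^2) set \<Rightarrow> (real^2 \<Rightarrow> real) \<Rightarrow> (real^2 \<Rightarrow> real^2) \<Rightarrow> bool" where
  "trivial_on U \<phi> J \<longleftrightarrow> (\<exists>a b. \<forall>p\<in>U. J p = (a * p $ 1 + b) *\<^sub>R ode_field \<phi> p)"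

definition nontrivial_jacobi_field ::
    "(real^2) set \<Rightarrow> (real^2 \<Rightarrow> real) \<Rightarrow> (real^2 \<Rightarrow> real^2) \<Rightarrow> bool" where
  "nontrivial_jacobi_field U \<phi> J \<longleftrightarrow>
     jacobi_field U (ode_metric \<phi>) (ode_field \<phi>) J \<and> \<not> trivial_on U \<phi> J"

text \<open>The one-form \<open>- \<phi> dx + du\<close>, evaluated at \<open>p\<close> on a tangent vector \<open>v\<close>.\<close>

definition ode_form :: "(real^2 \<Rightarrow> real) \<Rightarrow> real^2 \<Rightarrow> real^2 \<Rightarrow> real" where
  "ode_form \<phi> p v = - \<phi> p * v $ 1 + v $ 2"

definition integrating_factor_on ::
    "(real^2) set \<Rightarrow> (real^2 \<Rightarrow> real) \<Rightarrow> (real^2 \<Rightarrow> real) \<Rightarrow> bool" where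
  "integrating_factor_on V \<phi> \<mu> \<longleftrightarrow>
     open V \<and> smooth_on V \<mu> \<and> (\<forall>p\<in>V. \<mu> p \<noteq> 0) \<and>
     (\<exists>F. smooth_on V F \<and> (\<forall>p\<in>V. (F has_derivative (\<lambda>v. \<mu> p * ode_form \<phi> p v)) (at p)))"

definition sym_op :: "(real^2 \<Rightarrow> real) \<Rightarrow> (real^2 \<Rightarrow> real) \<Rightarrow> real^2 \<Rightarrow> real" where
  "sym_op \<phi> f p = vf_deriv (ode_field \<phi>) f p - partial 2 \<phi> p * f p"

definition delta_fun :: "real \<Rightarrow> real \<Rightarrow> real \<Rightarrow> real \<Rightarrow> real" where
  "delta_fun k c1 c2 x =
     (if k > 0 then c1 * cos (sqrt k * x) + c2 * sin (sqrt k * x)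
      else if k = 0 then c1 + c2 * x
      else c1 * cosh (sqrt (- k) * x) + c2 * sinh (sqrt (- k) * x))"

end

(* In the orthonormal frame A, d/du the curvature hypothesis is the Riccati equation
   A(phi_u) = - k - phi_u^2, while delta'' = - k delta; the latter is the Jacobi equation for
   delta d/du because A is geodesic. The form mu (- phi dx + du) is closed iff A(mu) + phi_u mu = 0,
   and then it is locally exact by the Poincare lemma. This equation holds for mu = 1 / delta if
   A(delta) = phi_u delta, and for mu = S(delta) it is the Riccati equation combined with
   delta'' = - k delta. *)

theory Submission
  imports Defs
begin

section \<open>Functions of class \<open>C\<^sup>k\<close>\<close>

text \<open>\<open>Ck_on\<close> is stated for total functions, but on an open set the Frechet
  derivative is local, so agreement on \<open>S\<close> passes to derivatives of every order. It
  allows a derivative to be replaced by a formula valid only on \<open>S\<close>.\<close>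

lemma Ck_on_cong:
  fixes f g :: "real^'n \<Rightarrow> 'b::real_normed_vector"
  assumes "open S" "Ck_on m S f" "\<And>p. p \<in> S \<Longrightarrow> f p = g p"
  shows "Ck_on m S g"
  using assms(2,3)
proof (induction m arbitrary: f g)
  case 0
  then show ?case by (simp cong: continuous_on_cong)
next
  case (Suc m)
  show ?case
    unfolding Ck_on.simps
  proof (intro conjI ballI allI)
    fix p assume "p \<in> S"
    then show "g differentiable (at p)"
      using Suc.prems \<open>open S\<close> unfolding differentiable_def
      by (metis Ck_on.simps(2) differentiable_def has_derivative_transform_within_open)
  next
    fix v
    have "frechet_derivative f (at p) v = frechet_derivative g (at p) v" if "p \<in> S" for p
      using frechet_derivative_transform_within_open[OF _ \<open>open S\<close> that] Suc.prems that
      by (metis Ck_on.simps(2))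
    then show "Ck_on m S (\<lambda>p. frechet_derivative g (at p) v)"
      by (rule Suc.IH[of "\<lambda>p. frechet_derivative f (at p) v", rotated]) (use Suc.prems(1) in auto)
  qed
qed

lemma Ck_on_Suc_imp_Ck_on: "Ck_on (Suc m) S f \<Longrightarrow> Ck_on m S f"
  by (induction m arbitrary: f)
    (auto simp: continuous_on_eq_continuous_within differentiable_imp_continuous_within
      intro: continuous_at_imp_continuous_at_within)

text \<open>Any explicit derivative \<open>f'\<close> may stand in for the chosen
  \<open>frechet_derivative\<close>. The closure proofs below differentiate once by a rule of
  calculus and apply the induction hypothesis to the resulting formula.\<close>

lemma Ck_on_SucI:
  assumes "open S" "\<And>p. p \<in> S \<Longrightarrow> (f has_derivative f' p) (at p)" "\<And>v. Ck_on m S (\<lambda>p. f' p v)"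
  shows "Ck_on (Suc m) S f"
  unfolding Ck_on.simps
proof (intro conjI ballI allI)
  fix p assume "p \<in> S"
  then show "f differentiable (at p)"
    using assms(2) by (auto simp: differentiable_def)
next
  fix v
  show "Ck_on m S (\<lambda>p. frechet_derivative f (at p) v)"
    by (rule Ck_on_cong[OF \<open>open S\<close> assms(3)[of v]]) (simp add: frechet_derivative_at[OF assms(2)])
qed

lemma Ck_on_Suc_has_derivative:
  "Ck_on (Suc m) S f \<Longrightarrow> p \<in> S \<Longrightarrow> (f has_derivative frechet_derivative f (at p)) (at p)"
  by (simp add: frechet_derivative_works)

lemma Ck_on_subset: "Ck_on m S f \<Longrightarrow> T \<subseteq> S \<Longrightarrow> Ck_on m T f"
  by (induction m arbitrary: f) (auto intro: continuous_on_subset)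

lemma Ck_on_const: "Ck_on m S (\<lambda>p. c)"
  by (induction m arbitrary: c) auto

lemma Ck_on_bounded_linear:
  assumes "open S" "bounded_linear h" "Ck_on m S f"
  shows "Ck_on m S (\<lambda>p. h (f p))"
  using assms(3)
proof (induction m arbitrary: f)
  case 0
  then show ?case
    using bounded_linear.continuous_on[OF assms(2)] by simp
next
  case (Suc m)
  show ?case
    by (rule Ck_on_SucI[OF \<open>open S\<close> bounded_linear.has_derivative[OF assms(2)
            Ck_on_Suc_has_derivative[OF Suc.prems]]])
      (use Suc in auto)
qed

lemma Ck_on_add:
  assumes "open S" "Ck_on m S f" "Ck_on m S g"
  shows "Ck_on m S (\<lambda>p. f p + g p)"
  using assms(2,3)
proof (induction m arbitrary: f g)
  case 0
  then show ?case
    by (simp add: continuous_on_add)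
next
  case (Suc m)
  show ?case
    by (rule Ck_on_SucI[OF \<open>open S\<close> has_derivative_add[OF
            Ck_on_Suc_has_derivative[OF Suc.prems(1)] Ck_on_Suc_has_derivative[OF Suc.prems(2)]]])
      (use Suc in auto)
qed

text \<open>The product rule leaves each factor once undifferentiated, so both factors are first
  lowered from class \<open>Suc m\<close> to class \<open>m\<close>.\<close>

lemma Ck_on_mult:
  fixes f g :: "real^'n \<Rightarrow> real"
  assumes "open S" "Ck_on m S f" "Ck_on m S g"
  shows "Ck_on m S (\<lambda>p. f p * g p)"
  using assms(2,3)
proof (induction m arbitrary: f g)
  case 0
  then show ?case
    by (simp add: continuous_on_mult)
next
  case (Suc m)
  note f = Ck_on_Suc_imp_Ck_on[OF Suc.prems(1)] and g = Ck_on_Suc_imp_Ck_on[OF Suc.prems(2)]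
  show ?case
    by (rule Ck_on_SucI[OF \<open>open S\<close> has_derivative_mult[OF
            Ck_on_Suc_has_derivative[OF Suc.prems(1)] Ck_on_Suc_has_derivative[OF Suc.prems(2)]]])
      (use Suc f g in \<open>auto intro!: Ck_on_add[OF \<open>open S\<close>]\<close>)
qed

text \<open>The derivative of \<open>1/f\<close> contains \<open>1/f\<close> itself, which is of
  class \<open>m\<close> by the induction hypothesis, so regularity is gained one order at a
  time.\<close>

lemma Ck_on_inverse:
  fixes f :: "real^'n \<Rightarrow> real"
  assumes "open S" "Ck_on m S f" "\<And>p. p \<in> S \<Longrightarrow> f p \<noteq> 0"
  shows "Ck_on m S (\<lambda>p. inverse (f p))"
  using assms(2)
proof (induction m)
  case 0
  then show ?case
    using assms(3) by (simp add: continuous_on_inverse)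
next
  case (Suc m)
  have "Ck_on m S (\<lambda>p. inverse (f p))"
    by (rule Suc.IH[OF Ck_on_Suc_imp_Ck_on[OF Suc.prems]])
  then have *: "Ck_on m S (\<lambda>p. - 1 * ((inverse (f p) * frechet_derivative f (at p) v) * inverse (f p)))" for v
    using Suc.prems by (intro Ck_on_mult[OF \<open>open S\<close>] Ck_on_const) auto
  show ?case
    by (rule Ck_on_SucI[OF \<open>open S\<close> Deriv.has_derivative_inverse[OF assms(3)
            Ck_on_Suc_has_derivative[OF Suc.prems]]]) (use * in simp_all)
qed

section \<open>Smooth functions and their derivatives\<close>

lemma smooth_on_has_derivative:
  "smooth_on S f \<Longrightarrow> p \<in> S \<Longrightarrow> (f has_derivative frechet_derivative f (at p)) (at p)"
  unfolding smooth_on_def using Ck_on_Suc_has_derivative by blast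

lemma smooth_on_differentiable: "smooth_on S f \<Longrightarrow> p \<in> S \<Longrightarrow> f differentiable (at p)"
  using smooth_on_has_derivative differentiableI by blast

lemma smooth_on_frechet_derivative: "smooth_on S f \<Longrightarrow> smooth_on S (\<lambda>p. frechet_derivative f (at p) v)"
  unfolding smooth_on_def by (metis Ck_on.simps(2))

lemma smooth_on_imp_continuous_on: "smooth_on S f \<Longrightarrow> continuous_on S f"
  unfolding smooth_on_def by (metis Ck_on.simps(1))

lemma smooth_on_partial: "smooth_on S f \<Longrightarrow> smooth_on S (partial i f)"
  using smooth_on_frechet_derivative by (simp add: partial_def vf_deriv_def[abs_def] coord_field_def)

lemma smooth_on_subset: "smooth_on S f \<Longrightarrow> T \<subseteq> S \<Longrightarrow> smooth_on T f"
  unfolding smooth_on_def using Ck_on_subset by blast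

lemma smooth_on_mult:
  fixes f g :: "real^'n \<Rightarrow> real"
  shows "open S \<Longrightarrow> smooth_on S f \<Longrightarrow> smooth_on S g \<Longrightarrow> smooth_on S (\<lambda>p. f p * g p)"
  unfolding smooth_on_def using Ck_on_mult by blast

section \<open>The Poincare lemma for one-forms\<close>

text \<open>A one-form is represented by the vector field \<omega> through the inner product.
  \<open>sym\<close>, the symmetry of its Jacobian, says that the form is closed, and convexity
  provides the segments along which it is integrated.\<close>

lemma poincare_convex:
  fixes \<omega> :: "'a::euclidean_space \<Rightarrow> 'a"
  assumes "open V" "convex V"
    and der: "\<And>q. q \<in> V \<Longrightarrow> (\<omega> has_derivative D q) (at q)"
    and cont: "\<And>v. continuous_on V (\<lambda>q. D q v)"
    and sym: "\<And>q v w. q \<in> V \<Longrightarrow> D q v \<bullet> w = D q w \<bullet> v"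
  shows "\<exists>F. \<forall>q\<in>V. (F has_derivative (\<lambda>v. \<omega> q \<bullet> v)) (at q)"
proof (cases "V = {}")
  case False
  then obtain p where p: "p \<in> V" by blast
  let ?\<gamma> = "\<lambda>q t. p + t *\<^sub>R (q - p)"
  have \<gamma>: "?\<gamma> q t \<in> V" if "q \<in> V" "t \<in> {0..1}" for q t
    using \<open>convex V\<close> p that by (auto simp: convex_alt algebra_simps)
  have bl: "bounded_linear (D q)" if "q \<in> V" for q
    using der[OF that] by (rule has_derivative_bounded_linear)
  \<comment> \<open>The primitive is the integral of \<open>\<omega>\<close> along the segment from \<open>p\<close>. By symmetry of \<open>D\<close>, the
    \<open>q\<close>-derivative of the integrand is the \<open>t\<close>-derivative of \<open>t \<omega>(\<gamma> q t) \<bullet> v\<close>.\<close>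
  define f where "f q t = \<omega> (?\<gamma> q t) \<bullet> (q - p)" for q t
  define f' where "f' q t v = t * (D (?\<gamma> q t) v \<bullet> (q - p)) + \<omega> (?\<gamma> q t) \<bullet> v" for q t v
  \<comment> \<open>Leibniz's rule takes the derivative of the integrand as an element of the normed
    space of bounded linear maps, so \<open>f' q t\<close> is bundled.\<close>
  define B where "B q t = Blinfun (f' q t)" for q t
  have cont_\<omega>: "continuous_on V \<omega>"
    using der has_derivative_continuous
    by (metis continuous_at_imp_continuous_on)
  have bl': "bounded_linear (f' q t)" if "q \<in> V" "t \<in> {0..1}" for q t
    unfolding f'_def
    by (intro bounded_linear_add bounded_linear_const_mult bounded_linear_inner_right
        bounded_linear_compose[OF bounded_linear_inner_left bl] \<gamma> that)
  then have B: "blinfun_apply (B q t) = f' q t" if "q \<in> V" "t \<in> {0..1}" for q t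
    using that unfolding B_def by (simp add: bounded_linear_Blinfun_apply)
  have fder: "((\<lambda>q. f q t) has_derivative f' q t) (at q within V)" if "q \<in> V" "t \<in> {0..1}" for q t
  proof -
    have "((\<lambda>q. ?\<gamma> q t) has_derivative (\<lambda>v. t *\<^sub>R v)) (at q within V)"
      by (auto intro!: derivative_eq_intros)
    then have "((\<lambda>q. \<omega> (?\<gamma> q t)) has_derivative (\<lambda>v. D (?\<gamma> q t) (t *\<^sub>R v))) (at q within V)"
      using has_derivative_compose der \<gamma> that by blast
    from has_derivative_inner[OF this has_derivative_diff[OF has_derivative_ident has_derivative_const], of p]
    show ?thesis
      unfolding f_def
      by (rule has_derivative_eq_rhs)
        (simp add: f'_def linear_simps[OF bl[OF \<gamma>[OF that]]] add.commute fun_eq_iff)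
  qed
  have cont_f: "continuous_on {0..1} (f q)" if "q \<in> V" for q
    unfolding f_def
    by (intro continuous_intros continuous_on_compose2[OF cont_\<omega>]) (use \<gamma> that in auto)
  have cont_f': "continuous_on (V \<times> {0..1}) (\<lambda>(q, t). f' q t v)" for v
    unfolding f'_def split_beta
    by (intro continuous_intros continuous_on_compose2[OF cont_\<omega>] continuous_on_compose2[OF cont])
      (use \<gamma> in auto)
  \<comment> \<open>In finite dimension, continuity in the operator norm follows from continuity at
    each fixed vector \<open>v\<close>.\<close>
  have cont_B: "continuous_on (V \<times> {0..1}) (\<lambda>(q, t). B q t)"
    by (rule continuous_on_blinfun_componentwise, rule continuous_on_eq[OF cont_f'])
      (auto simp: B)
  have int_B: "blinfun_apply (integral {0..1} (B q)) = (\<lambda>v. \<omega> q \<bullet> v)" if q: "q \<in> V" for q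
  proof
    fix v
    have "continuous_on {0..1} (\<lambda>t. case (q, t) of (q, t) \<Rightarrow> B q t)"
      by (rule continuous_on_compose2[OF cont_B]) (use q in \<open>auto intro!: continuous_intros\<close>)
    then have "B q integrable_on {0..1}"
      by (simp add: integrable_continuous_real)
    then have "blinfun_apply (integral {0..1} (B q)) v = integral {0..1} (\<lambda>t. B q t v)"
      by (rule blinfun_apply_integral)
    also have "\<dots> = integral {0..1} (\<lambda>t. f' q t v)"
      by (rule integral_cong) (simp add: B q)
    \<comment> \<open>The boundary term at 0 vanishes because of the factor \<open>t\<close>; at 1
      the segment has reached \<open>q\<close>.\<close>
    also have "\<dots> = 1 *\<^sub>R \<omega> (?\<gamma> q 1) \<bullet> v - 0 *\<^sub>R \<omega> (?\<gamma> q 0) \<bullet> v"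
    proof (rule integral_unique, rule fundamental_theorem_of_calculus)
      fix t :: real assume t: "t \<in> {0..1}"
      have "((\<lambda>t. ?\<gamma> q t) has_derivative (\<lambda>s. s *\<^sub>R (q - p))) (at t within {0..1})"
        by (auto intro!: derivative_eq_intros)
      then have "((\<lambda>t. \<omega> (?\<gamma> q t)) has_derivative (\<lambda>s. D (?\<gamma> q t) (s *\<^sub>R (q - p)))) (at t within {0..1})"
        using has_derivative_compose der \<gamma> q t by blast
      moreover have "D (?\<gamma> q t) (s *\<^sub>R (q - p)) = s *\<^sub>R D (?\<gamma> q t) (q - p)" for s
        by (simp only: linear_simps(5)[OF bl[OF \<gamma>[OF q t]]])
      ultimately have "((\<lambda>t. \<omega> (?\<gamma> q t)) has_derivative (\<lambda>s. s *\<^sub>R D (?\<gamma> q t) (q - p))) (at t within {0..1})"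
        by simp
      from has_derivative_inner_left[OF has_derivative_scaleR[OF has_derivative_ident this], of v]
      show "((\<lambda>t. t *\<^sub>R \<omega> (?\<gamma> q t) \<bullet> v) has_vector_derivative f' q t v) (at t within {0..1})"
        unfolding has_vector_derivative_def
        by (rule has_derivative_eq_rhs)
          (simp add: f'_def sym[OF \<gamma>[OF q t], of v] inner_add_left distrib_left mult_ac add.commute)
    qed simp
    finally show "blinfun_apply (integral {0..1} (B q)) v = \<omega> q \<bullet> v" by simp
  qed
  have "((\<lambda>q. integral {0..1} (f q)) has_derivative (\<lambda>v. \<omega> q \<bullet> v)) (at q)" if q: "q \<in> V" for q
  proof -
    have "((\<lambda>q. integral (cbox 0 1) (f q)) has_derivative integral (cbox 0 1) (B q)) (at q within V)"
      by (rule leibniz_rule[OF _ _ _ q \<open>convex V\<close>])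
        (use fder cont_B cont_f in \<open>auto simp: B intro!: integrable_continuous_real\<close>)
    then show ?thesis
      using int_B[OF q] at_within_open[OF q \<open>open V\<close>] by simp
  qed
  then show ?thesis by blast
qed simp

section \<open>Connection and curvature of the associated surface\<close>

lemma vec_eq_axis_2: "(v :: real^2) = v $ 1 *\<^sub>R axis 1 1 + v $ 2 *\<^sub>R axis 2 1"
  by (simp add: vec_eq_iff forall_2 axis_def)

lemma frechet_derivative_eq_partials:
  fixes f :: "real^2 \<Rightarrow> real"
  assumes "f differentiable (at p)"
  shows "frechet_derivative f (at p) v = partial 1 f p * v $ 1 + partial 2 f p * v $ 2"
proof -
  interpret linear "frechet_derivative f (at p)"
    using assms by (rule linear_frechet_derivative)
  have "frechet_derivative f (at p) v =
      frechet_derivative f (at p) (v $ 1 *\<^sub>R axis 1 1 + v $ 2 *\<^sub>R axis 2 1)"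
    using vec_eq_axis_2[of v] by simp
  then show ?thesis
    by (simp add: add scale partial_def vf_deriv_def coord_field_def)
qed

lemma has_derivative_partials:
  fixes f :: "real^2 \<Rightarrow> real"
  assumes "f differentiable (at p)"
  shows "(f has_derivative (\<lambda>v. partial 1 f p * v $ 1 + partial 2 f p * v $ 2)) (at p)"
  using frechet_derivative_eq_partials[OF assms] frechet_derivative_works[of f "at p"] assms
  by (metis (no_types, lifting) ext)

lemma vf_deriv_eq: "(f has_derivative f') (at p) \<Longrightarrow> vf_deriv X f p = f' (X p)"
  by (simp add: vf_deriv_def frechet_derivative_at[symmetric])

lemma partial_eq: "(f has_derivative f') (at p) \<Longrightarrow> partial i f p = f' (axis i 1)"
  by (simp add: partial_def vf_deriv_eq coord_field_def)

section \<open>The vector field, the metric and the connection in coordinates\<close>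

lemma ode_field_nth [simp]: "ode_field \<phi> p $ 1 = 1" "ode_field \<phi> p $ 2 = \<phi> p"
  by (simp_all add: ode_field_def coord_field_def axis_def)

lemma coord_field_nth [simp]: "coord_field i p $ j = (if i = j then 1 else 0)"
  by (auto simp: coord_field_def axis_def)

lemma ode_metric_nth [simp]:
  "ode_metric \<phi> p $ 1 $ 1 = 1 + (\<phi> p)\<^sup>2" "ode_metric \<phi> p $ 1 $ 2 = - \<phi> p"
  "ode_metric \<phi> p $ 2 $ 1 = - \<phi> p" "ode_metric \<phi> p $ 2 $ 2 = 1"
  by (simp_all add: ode_metric_def)

lemma det_ode_metric: "det (ode_metric \<phi> p) = 1"
  by (simp add: det_2 power2_eq_square)

text \<open>Since the determinant is 1, the inverse is the adjugate. \<open>matrix_inv\<close> is a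
  Hilbert choice, so the equation comes from uniqueness of the two-sided inverse.\<close>

lemma matrix_inv_ode_metric:
  "matrix_inv (ode_metric \<phi> p) = vector [vector [1, \<phi> p], vector [\<phi> p, 1 + (\<phi> p)\<^sup>2]]" (is "_ = ?B")
proof -
  have AB: "ode_metric \<phi> p ** ?B = mat 1" "?B ** ode_metric \<phi> p = mat 1"
    by (simp_all add: matrix_matrix_mult_def vec_eq_iff forall_2 sum_2 mat_def power2_eq_square algebra_simps)
  then have "ode_metric \<phi> p ** matrix_inv (ode_metric \<phi> p) = mat 1"
    unfolding matrix_inv_def by (rule_tac someI2[of _ ?B]) auto
  then have "(?B ** ode_metric \<phi> p) ** matrix_inv (ode_metric \<phi> p) = ?B"
    by (simp add: matrix_mul_assoc[symmetric])
  then show ?thesis by (simp add: AB)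
qed

text \<open>This is the frame formula for the connection in coordinates: if
  \<open>X = x1 A + x2 d/du\<close>, then \<open>x1 = X $ 1\<close> and
  \<open>x2 = X $ 2 - \<phi> * X $ 1\<close>. The brackets are therefore \<open>- x2\<close> and
  \<open>- y2\<close>, and the factor of \<open>X $ 1 * Y $ 1\<close> is
  \<open>A(\<phi>)\<close>.\<close>

lemma levi_civita_ode_metric:
  assumes "\<phi> differentiable (at p)"
  shows "levi_civita (ode_metric \<phi>) X Y p $ 1 = vf_deriv X (\<lambda>q. Y q $ 1) p
      - partial 2 \<phi> p * (\<phi> p * X p $ 1 - X p $ 2) * (\<phi> p * Y p $ 1 - Y p $ 2)"
    and "levi_civita (ode_metric \<phi>) X Y p $ 2 = vf_deriv X (\<lambda>q. Y q $ 2) p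
      - (partial 1 \<phi> p + \<phi> p * partial 2 \<phi> p) * X p $ 1 * Y p $ 1
      - \<phi> p * partial 2 \<phi> p * (\<phi> p * X p $ 1 - X p $ 2) * (\<phi> p * Y p $ 1 - Y p $ 2)"
proof -
  note d = has_derivative_partials[OF assms]
  have 1: "partial i (\<lambda>q. 1 + (\<phi> q)\<^sup>2) p = 2 * \<phi> p * partial i \<phi> p" for i
    by (subst partial_eq, (rule derivative_eq_intros d refl)+) (simp add: partial_eq[OF d, of i])
  have 2: "partial i (\<lambda>q. - \<phi> q) p = - partial i \<phi> p" for i
    by (subst partial_eq, (rule derivative_eq_intros d refl)+) (simp add: partial_eq[OF d, of i])
  have 3: "partial i (\<lambda>q. c) p = 0" for i and c :: real
    by (subst partial_eq[OF has_derivative_const]) simp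
  note simps = levi_civita_def christoffel_def sum_2 matrix_inv_ode_metric 1 2 3
  show "levi_civita (ode_metric \<phi>) X Y p $ 1 = vf_deriv X (\<lambda>q. Y q $ 1) p
      - partial 2 \<phi> p * (\<phi> p * X p $ 1 - X p $ 2) * (\<phi> p * Y p $ 1 - Y p $ 2)"
    by (simp add: simps field_simps)
  show "levi_civita (ode_metric \<phi>) X Y p $ 2 = vf_deriv X (\<lambda>q. Y q $ 2) p
      - (partial 1 \<phi> p + \<phi> p * partial 2 \<phi> p) * X p $ 1 * Y p $ 1
      - \<phi> p * partial 2 \<phi> p * (\<phi> p * X p $ 1 - X p $ 2) * (\<phi> p * Y p $ 1 - Y p $ 2)"
    by (simp add: simps field_simps) (simp add: power2_eq_square algebra_simps)
qed

text \<open>The closed forms of covariant derivatives hold only on \<open>U\<close>. As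
  \<open>U\<close> is open, they can still be differentiated at \<open>p\<close>.\<close>

lemma vf_deriv_cong:
  assumes "(f has_derivative f') (at p)" "open U" "p \<in> U" "\<And>q. q \<in> U \<Longrightarrow> g q = f q"
  shows "vf_deriv X g p = f' (X p)"
  using has_derivative_transform_within_open[OF assms(1-3)] assms(4) by (simp add: vf_deriv_eq)

text \<open>The right-hand side is \<open>- (A(\<phi>_u) + \<phi>_u^2)\<close>, the expanded form of
  \<open>- d/du (A(\<phi>))\<close>. Prescribing the curvature thus gives a Riccati equation for
  \<open>\<phi>_u\<close> along \<open>A\<close>.\<close>

lemma gaussian_curvature_ode_metric:
  assumes "open U" "smooth_on U \<phi>" "p \<in> U"
  shows "gaussian_curvature (ode_metric \<phi>) p =
    - (partial 1 (partial 2 \<phi>) p + \<phi> p * partial 2 (partial 2 \<phi>) p + (partial 2 \<phi> p)\<^sup>2)"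
proof -
  let ?G = "ode_metric \<phi>" and ?b = "partial 2 \<phi>"
  have dU: "\<phi> differentiable (at q)" if "q \<in> U" for q
    using assms that by (auto intro: smooth_on_differentiable)
  note d = has_derivative_partials[OF dU[OF \<open>p \<in> U\<close>]]
    and db = has_derivative_partials[OF smooth_on_differentiable[OF smooth_on_partial[OF assms(2)] \<open>p \<in> U\<close>], of 2]
  have const: "vf_deriv X (\<lambda>q. c) q = 0" for X and c :: real and q :: "real^2"
    by (simp add: vf_deriv_def)
  note lc = levi_civita_ode_metric[OF dU]
  \<comment> \<open>Both fields are multiples of \<open>A\<close>: the covariant derivative of
    \<open>d/du\<close> is \<open>- \<phi>_u A\<close> along \<open>d/du\<close> and
    \<open>\<phi> \<phi>_u A\<close> along \<open>d/dx\<close>.\<close>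
  have W: "levi_civita ?G (coord_field 2) (coord_field 2) q $ 1 = - ?b q"
      "levi_civita ?G (coord_field 2) (coord_field 2) q $ 2 = - (\<phi> q * ?b q)"
      "levi_civita ?G (coord_field 1) (coord_field 2) q $ 1 = \<phi> q * ?b q"
      "levi_civita ?G (coord_field 1) (coord_field 2) q $ 2 = (\<phi> q)\<^sup>2 * ?b q" if "q \<in> U" for q
    by (simp_all add: lc that const power2_eq_square)
  have bracket: "lie_bracket (coord_field 1) (coord_field 2) q = (0 :: real^2)" for q
    by (simp add: lie_bracket_def vf_deriv_def coord_field_def[abs_def])
  have Z: "levi_civita ?G (lie_bracket (coord_field 1) (coord_field 2)) (coord_field 2) p = 0"
    by (simp add: vec_eq_iff forall_2 lc \<open>p \<in> U\<close> bracket const)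
  note vd = vf_deriv_cong[OF _ \<open>open U\<close> \<open>p \<in> U\<close>]
  have V: "vf_deriv (coord_field 1) (\<lambda>q. levi_civita ?G (coord_field 2) (coord_field 2) q $ 1) p = - partial 1 ?b p"
      "vf_deriv (coord_field 1) (\<lambda>q. levi_civita ?G (coord_field 2) (coord_field 2) q $ 2) p
        = - (\<phi> p * partial 1 ?b p + partial 1 \<phi> p * ?b p)"
      "vf_deriv (coord_field 2) (\<lambda>q. levi_civita ?G (coord_field 1) (coord_field 2) q $ 1) p
        = \<phi> p * partial 2 ?b p + ?b p * ?b p"
      "vf_deriv (coord_field 2) (\<lambda>q. levi_civita ?G (coord_field 1) (coord_field 2) q $ 2) p
        = (\<phi> p)\<^sup>2 * partial 2 ?b p + 2 * \<phi> p * ?b p * ?b p"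
    by (subst vd[OF _ W(1)], (rule derivative_eq_intros d db refl | assumption)+, simp)
      (subst vd[OF _ W(2)], (rule derivative_eq_intros d db refl | assumption)+, simp,
       subst vd[OF _ W(3)], (rule derivative_eq_intros d db refl | assumption)+, simp,
       subst vd[OF _ W(4)], (rule derivative_eq_intros d db refl | assumption)+, simp)
  \<comment> \<open>The curvature vector is \<open>- (A(\<phi>_u) + \<phi>_u^2) A\<close>. Its
    product with \<open>d/dx\<close> is its coefficient, because
    \<open>g(A, d/dx) = 1\<close>.\<close>
  have "levi_civita ?G (coord_field 1) (levi_civita ?G (coord_field 2) (coord_field 2)) p $ 1
      - levi_civita ?G (coord_field 2) (levi_civita ?G (coord_field 1) (coord_field 2)) p $ 1
      = - (partial 1 ?b p + \<phi> p * partial 2 ?b p + (?b p)\<^sup>2)"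
    "levi_civita ?G (coord_field 1) (levi_civita ?G (coord_field 2) (coord_field 2)) p $ 2
      - levi_civita ?G (coord_field 2) (levi_civita ?G (coord_field 1) (coord_field 2)) p $ 2
      = - \<phi> p * (partial 1 ?b p + \<phi> p * partial 2 ?b p + (?b p)\<^sup>2)"
    by (simp_all add: lc \<open>p \<in> U\<close> V W const) (simp_all add: power2_eq_square algebra_simps)
  then show ?thesis
    by (simp add: gaussian_curvature_def det_ode_metric metric_at_def inner_vec_def
        matrix_vector_mult_def sum_2 riemann_curvature_def Z) (simp add: power2_eq_square algebra_simps)
qed

section \<open>Integrating factors\<close>

text \<open>The exterior derivative of \<open>\<mu> (- \<phi> dx + du)\<close> is \<open>(\<mu>_x +
  (\<phi> \<mu>)_u) dx du = (A(\<mu>) + \<phi>_u \<mu>) dx du\<close>, so \<open>eq\<close>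
  expresses closedness, and the Poincare lemma on the convex set \<open>V\<close> gives
  \<open>F\<close>.\<close>

lemma integrating_factor_onI:
  assumes V: "open V" "convex V"
    and smooth: "smooth_on V \<phi>" "smooth_on V \<mu>"
    and nz: "\<And>p. p \<in> V \<Longrightarrow> \<mu> p \<noteq> 0"
    and eq: "\<And>p. p \<in> V \<Longrightarrow> vf_deriv (ode_field \<phi>) \<mu> p + partial 2 \<phi> p * \<mu> p = 0"
  shows "integrating_factor_on V \<phi> \<mu>"
proof -
  note d\<phi> = smooth_on_has_derivative[OF smooth(1)] and d\<mu> = smooth_on_has_derivative[OF smooth(2)]
  let ?d\<phi> = "\<lambda>q. frechet_derivative \<phi> (at q)" and ?d\<mu> = "\<lambda>q. frechet_derivative \<mu> (at q)"
  define \<omega> :: "real^2 \<Rightarrow> real^2" where "\<omega> q = - (\<phi> q * \<mu> q) *\<^sub>R axis 1 1 + \<mu> q *\<^sub>R axis 2 1" for q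
  define D :: "real^2 \<Rightarrow> real^2 \<Rightarrow> real^2" where
    "D q v = - (\<phi> q * ?d\<mu> q v + ?d\<phi> q v * \<mu> q) *\<^sub>R axis 1 1 + ?d\<mu> q v *\<^sub>R axis 2 1" for q v
  have "\<exists>F. \<forall>q\<in>V. (F has_derivative (\<lambda>v. \<omega> q \<bullet> v)) (at q)"
  proof (rule poincare_convex[OF V])
    fix q assume "q \<in> V"
    then show "(\<omega> has_derivative D q) (at q)"
      unfolding \<omega>_def[abs_def] D_def[abs_def]
      by (intro has_derivative_add has_derivative_scaleR_left has_derivative_minus
          has_derivative_mult d\<phi> d\<mu>)
  next
    fix v
    show "continuous_on V (\<lambda>q. D q v)"
      unfolding D_def
      by (intro continuous_intros smooth_on_imp_continuous_on smooth smooth_on_frechet_derivative)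
  next
    fix q v w assume "q \<in> V"
    note fd = frechet_derivative_eq_partials[OF smooth_on_differentiable[OF smooth(1) \<open>q \<in> V\<close>]]
      frechet_derivative_eq_partials[OF smooth_on_differentiable[OF smooth(2) \<open>q \<in> V\<close>]]
    \<comment> \<open>Solving the closedness equation for \<open>\<mu>_x\<close> reduces the
      symmetry of \<open>D\<close> to a polynomial identity.\<close>
    have "partial 1 \<mu> q = - \<phi> q * partial 2 \<mu> q - partial 2 \<phi> q * \<mu> q"
      using eq[OF \<open>q \<in> V\<close>] unfolding vf_deriv_def fd ode_field_nth by argo
    then show "D q v \<bullet> w = D q w \<bullet> v"
      by (simp add: D_def inner_add_left inner_axis' fd) (simp add: algebra_simps)
  qed
  then obtain F where F: "\<And>q. q \<in> V \<Longrightarrow> (F has_derivative (\<lambda>v. \<mu> q * ode_form \<phi> q v)) (at q)"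
    by (auto simp: \<omega>_def ode_form_def inner_add_left inner_axis' algebra_simps)
  \<comment> \<open>Smoothness of \<open>F\<close> is read off from its derivative, whose value at
    each fixed vector is of class \<open>m\<close> for every \<open>m\<close>.\<close>
  have "Ck_on m V (\<lambda>q. \<mu> q * ode_form \<phi> q v)" for m v
    using smooth unfolding smooth_on_def ode_form_def
    by (intro Ck_on_mult[OF \<open>open V\<close>] Ck_on_add[OF \<open>open V\<close>] Ck_on_const
        Ck_on_bounded_linear[OF \<open>open V\<close> bounded_linear_minus[OF bounded_linear_ident]]) auto
  then have "smooth_on V F"
    unfolding smooth_on_def using Ck_on_Suc_imp_Ck_on Ck_on_SucI[OF \<open>open V\<close> F] by blast
  then show ?thesis
    unfolding integrating_factor_on_def using V smooth nz F by blast
qed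

section \<open>The function \<open>\<delta>\<close> and Jacobi fields\<close>

text \<open>The derivative is encoded as a \<open>delta_fun\<close> with exchanged and rescaled
  coefficients, so facts about \<open>delta_fun\<close> apply to it again. For \<open>k = 0\<close>
  the scale \<open>s\<close> is 1 rather than 0, which gives the constant \<open>c2\<close>.\<close>

definition delta_deriv :: "real \<Rightarrow> real \<Rightarrow> real \<Rightarrow> real \<Rightarrow> real" where
  "delta_deriv k c1 c2 =
    (let s = if k = 0 then 1 else sqrt \<bar>k\<bar> in delta_fun k (s * c2) (- sgn k * s * c1))"

lemma has_real_derivative_delta_fun:
  "(delta_fun k c1 c2 has_real_derivative delta_deriv k c1 c2 x) (at x)"
proof -
  consider "k > 0" | "k = 0" | "k < 0" by linarith
  then show ?thesis
    by cases (auto simp: delta_fun_def[abs_def] delta_deriv_def Let_def algebra_simps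
        intro!: derivative_eq_intros)
qed

text \<open>Two applications of the coefficient map multiply both coefficients by
  \<open>- sgn k * s^2 = - k\<close>, also for \<open>k = 0\<close>.\<close>

lemma has_real_derivative_delta_deriv:
  "(delta_deriv k c1 c2 has_real_derivative - k * delta_fun k c1 c2 x) (at x)"
proof -
  have "(delta_deriv k c1 c2 has_real_derivative
      (let s = if k = 0 then 1 else sqrt \<bar>k\<bar> in
        delta_deriv k (s * c2) (- sgn k * s * c1) x)) (at x)"
    unfolding delta_deriv_def[of k c1 c2] Let_def by (rule has_real_derivative_delta_fun)
  moreover have "(let s = if k = 0 then 1 else sqrt \<bar>k\<bar> in
        delta_deriv k (s * c2) (- sgn k * s * c1) x) = - k * delta_fun k c1 c2 x"
    by (auto simp: delta_deriv_def delta_fun_def Let_def algebra_simps)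
  ultimately show ?thesis by simp
qed

text \<open>The Wronskian of the two basic solutions never vanishes. For nonzero \<open>k\<close>,
  dividing the derivative by \<open>sqrt \<bar>k\<bar>\<close> turns it into
  \<open>cos^2 + sin^2 = 1\<close> or \<open>cosh^2 - sinh^2 = 1\<close>.\<close>

lemma delta_fun_eq_0_imp:
  assumes "delta_fun k c1 c2 x = 0" "delta_deriv k c1 c2 x = 0"
  shows "c1 = 0 \<and> c2 = 0"
proof -
  \<comment> \<open>Cramer's rule for a homogeneous system of determinant 1.\<close>
  have solve: "c1 = 0 \<and> c2 = 0"
    if "c1 * a + c2 * b = 0" "c1 * c + c2 * d = 0" "a * d - b * c = 1" for a b c d :: real
  proof -
    have "c1 * (a * d - b * c) = d * (c1 * a + c2 * b) - b * (c1 * c + c2 * d)"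
      by (simp add: algebra_simps)
    then have "c1 = 0"
      unfolding that by simp
    have "c2 * (a * d - b * c) = a * (c1 * c + c2 * d) - c * (c1 * a + c2 * b)"
      by (simp add: algebra_simps)
    then have "c2 = 0"
      unfolding that by simp
    with \<open>c1 = 0\<close> show ?thesis ..
  qed
  consider "k > 0" | "k = 0" | "k < 0" by linarith
  then show ?thesis
  proof cases
    case 1
    have "delta_deriv k c1 c2 x = sqrt k * (c1 * - sin (sqrt k * x) + c2 * cos (sqrt k * x))"
      using 1 by (simp add: delta_deriv_def delta_fun_def Let_def) (simp add: algebra_simps)
    moreover have "sqrt k \<noteq> 0"
      using 1 by simp
    ultimately have deriv: "c1 * - sin (sqrt k * x) + c2 * cos (sqrt k * x) = 0"
      using assms(2) by (metis mult_eq_0_iff)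
    have "delta_fun k c1 c2 x = c1 * cos (sqrt k * x) + c2 * sin (sqrt k * x)"
      using 1 by (simp add: delta_fun_def)
    then have fun_eq: "c1 * cos (sqrt k * x) + c2 * sin (sqrt k * x) = 0"
      using assms(1) by (rule trans[OF sym])
    have det: "cos (sqrt k * x) * cos (sqrt k * x) - sin (sqrt k * x) * - sin (sqrt k * x) = 1"
      using sin_cos_squared_add[of "sqrt k * x"] by (simp add: power2_eq_square)
    show ?thesis
      by (rule solve[OF fun_eq deriv det])
  next
    case 2
    then show ?thesis
      using assms by (simp add: delta_deriv_def delta_fun_def)
  next
    case 3
    have "delta_deriv k c1 c2 x = sqrt (- k) * (c1 * sinh (sqrt (- k) * x) + c2 * cosh (sqrt (- k) * x))"
      using 3 by (simp add: delta_deriv_def delta_fun_def Let_def) (simp add: algebra_simps)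
    moreover have "sqrt (- k) \<noteq> 0"
      using 3 by simp
    ultimately have deriv: "c1 * sinh (sqrt (- k) * x) + c2 * cosh (sqrt (- k) * x) = 0"
      using assms(2) by (metis mult_eq_0_iff)
    have "delta_fun k c1 c2 x = c1 * cosh (sqrt (- k) * x) + c2 * sinh (sqrt (- k) * x)"
      using 3 by (simp add: delta_fun_def)
    then have fun_eq: "c1 * cosh (sqrt (- k) * x) + c2 * sinh (sqrt (- k) * x) = 0"
      using assms(1) by (rule trans[OF sym])
    have det: "cosh (sqrt (- k) * x) * cosh (sqrt (- k) * x) - sinh (sqrt (- k) * x) * sinh (sqrt (- k) * x) = 1"
      using hyperbolic_pythagoras[of "sqrt (- k) * x"] by (simp add: power2_eq_square)
    show ?thesis
      by (rule solve[OF fun_eq deriv det])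
  qed
qed

section \<open>Functions of a single coordinate\<close>

lemma has_derivative_comp_nth:
  assumes "(f has_real_derivative d) (at (p $ i))"
  shows "((\<lambda>p. f (p $ i)) has_derivative (\<lambda>v. d * v $ i)) (at p)"
  using has_derivative_compose[OF bounded_linear_imp_has_derivative[OF bounded_linear_vec_nth[of i]]
      assms[unfolded has_field_derivative_def]] .

text \<open>The coefficients stay general in the induction because the derivative is a
  \<open>delta_fun\<close> with other coefficients.\<close>

lemma Ck_on_delta_fun:
  assumes "open S"
  shows "Ck_on m S (\<lambda>p. delta_fun k c1 c2 (p $ i))"
proof (induction m arbitrary: c1 c2)
  case 0
  have "isCont (\<lambda>p. delta_fun k c1 c2 (p $ i)) p" for p
    by (rule has_derivative_continuous[OF has_derivative_comp_nth[OF has_real_derivative_delta_fun]])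
  then show ?case
    by (simp add: continuous_at_imp_continuous_on)
next
  case (Suc m)
  have "Ck_on m S (\<lambda>p. delta_deriv k c1 c2 (p $ i) * v $ i)" for v
    unfolding delta_deriv_def Let_def by (intro Ck_on_mult assms Ck_on_const Suc.IH)
  then show ?case
    by (rule Ck_on_SucI[OF assms has_derivative_comp_nth[OF has_real_derivative_delta_fun]])
qed

lemma smooth_on_delta_fun: "open S \<Longrightarrow> smooth_on S (\<lambda>p. delta_fun k c1 c2 (p $ i))"
  by (simp add: smooth_on_def Ck_on_delta_fun)

lemma smooth_on_delta_deriv: "open S \<Longrightarrow> smooth_on S (\<lambda>p. delta_deriv k c1 c2 (p $ i))"
  by (simp add: delta_deriv_def Let_def smooth_on_delta_fun)

lemma vf_deriv_ode_field_comp_x: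
  "(f has_real_derivative d) (at (p $ 1)) \<Longrightarrow> vf_deriv (ode_field \<phi>) (\<lambda>p. f (p $ 1)) p = d"
  by (simp add: vf_deriv_eq[OF has_derivative_comp_nth])

text \<open>The field \<open>d/du\<close> is parallel along \<open>A\<close>, a unit field
  orthogonal to it. For \<open>f(x) d/du\<close> the Jacobi equation therefore reduces to
  \<open>f'' + k f = 0\<close>.\<close>

lemma jacobi_field_scaleR_vertical:
  assumes U: "open U" and \<phi>: "smooth_on U \<phi>"
    and curv: "\<And>p. p \<in> U \<Longrightarrow> gaussian_curvature (ode_metric \<phi>) p = k"
    and smooth: "smooth_on U (\<lambda>p. f (p $ 1))"
    and f: "\<And>x. (f has_real_derivative f' x) (at x)"
    and f': "\<And>x. (f' has_real_derivative - k * f x) (at x)"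
  shows "jacobi_field U (ode_metric \<phi>) (ode_field \<phi>) (\<lambda>p. f (p $ 1) *\<^sub>R coord_field 2 p)"
    (is "jacobi_field U ?G ?A ?J")
  unfolding jacobi_field_def
proof (intro conjI ballI)
  show "smooth_on U ?J"
    using smooth Ck_on_bounded_linear[OF U bounded_linear_scaleR_left]
    unfolding smooth_on_def coord_field_def by blast
next
  fix p assume p: "p \<in> U"
  note lc = levi_civita_ode_metric[OF smooth_on_differentiable[OF \<phi>]]
  have const: "vf_deriv X (\<lambda>q. c) q = 0" for X and c :: real and q :: "real^2"
    by (simp add: vf_deriv_def)
  \<comment> \<open>The connection terms drop out: \<open>A\<close> has no \<open>d/du\<close>
    component in the frame, and the first coordinate of \<open>J\<close> is zero.\<close>
  have 1: "levi_civita ?G ?A ?J q $ 1 = 0" "levi_civita ?G ?A ?J q $ 2 = f' (q $ 1)" if "q \<in> U" for q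
    using that by (simp_all add: lc const vf_deriv_ode_field_comp_x[OF f])
  have "vf_deriv ?A (\<lambda>q. levi_civita ?G ?A ?J q $ 1) p = 0"
    by (rule vf_deriv_cong[OF has_derivative_const U p 1(1)])
  moreover have "vf_deriv ?A (\<lambda>q. levi_civita ?G ?A ?J q $ 2) p = - k * f (p $ 1)"
    by (subst vf_deriv_cong[OF has_derivative_comp_nth[OF f'] U p 1(2)]) simp_all
  ultimately show "levi_civita ?G ?A (levi_civita ?G ?A ?J) p
      + gaussian_curvature ?G p *\<^sub>R (metric_at ?G p (?A p) (?A p) *\<^sub>R ?J p
        - metric_at ?G p (?J p) (?A p) *\<^sub>R ?A p) = 0"
    by (simp add: vec_eq_iff forall_2 lc p 1 const curv metric_at_def inner_vec_def matrix_vector_mult_def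
        sum_2 power2_eq_square algebra_simps)
qed

section \<open>Jacobi field and integrating factors in constant curvature\<close>

theorem mainTheorem2:
  fixes U :: "(real^2) set" and \<phi> :: "real^2 \<Rightarrow> real" and k c1 c2 :: real
    and \<delta> :: "real^2 \<Rightarrow> real"
  defines "\<delta> \<equiv> (\<lambda>p. delta_fun k c1 c2 (p $ 1))"
  assumes "open U" and "connected U" and "U \<noteq> {}"
    and "smooth_on U \<phi>"
    and "\<forall>p\<in>U. gaussian_curvature (ode_metric \<phi>) p = k"
    and "\<not> (c1 = 0 \<and> c2 = 0)"
  shows "nontrivial_jacobi_field U \<phi> (\<lambda>p. \<delta> p *\<^sub>R coord_field 2 p)
    \<and> ((\<forall>p\<in>U. sym_op \<phi> \<delta> p = 0) \<longrightarrow>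
        (\<forall>p\<in>U. \<delta> p \<noteq> 0 \<longrightarrow>
          (\<exists>V. open V \<and> p \<in> V \<and> V \<subseteq> U \<and> integrating_factor_on V \<phi> (\<lambda>q. inverse (\<delta> q)))))
    \<and> (\<not> (\<forall>p\<in>U. sym_op \<phi> \<delta> p = 0) \<longrightarrow>
        (\<forall>p\<in>U. sym_op \<phi> \<delta> p \<noteq> 0 \<longrightarrow>
          (\<exists>V. open V \<and> p \<in> V \<and> V \<subseteq> U \<and> integrating_factor_on V \<phi> (sym_op \<phi> \<delta>))))"
proof (intro conjI impI ballI)
  note U = \<open>open U\<close> and \<phi> = \<open>smooth_on U \<phi>\<close>
  have d\<delta>: "(\<delta> has_derivative (\<lambda>v. delta_deriv k c1 c2 (p $ 1) * v $ 1)) (at p)" for p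
    unfolding \<delta>_def by (rule has_derivative_comp_nth[OF has_real_derivative_delta_fun])
  have smooth_\<delta>: "smooth_on U \<delta>"
    unfolding \<delta>_def by (rule smooth_on_delta_fun[OF U])
  \<comment> \<open>\<open>A(\<delta>)\<close> is the ordinary derivative of \<delta>, which depends
    on \<open>x\<close> alone, since the first coordinate of \<open>A\<close> is 1.\<close>
  have sym_op: "sym_op \<phi> \<delta> p = delta_deriv k c1 c2 (p $ 1) - partial 2 \<phi> p * \<delta> p" for p
    by (simp add: sym_op_def vf_deriv_eq[OF d\<delta>])
  have smooth_sym: "smooth_on U (sym_op \<phi> \<delta>)"
  proof -
    have "smooth_on U (\<lambda>p. delta_deriv k c1 c2 (p $ 1) + - (partial 2 \<phi> p * \<delta> p))"
      using smooth_on_mult[OF U smooth_on_partial[OF \<phi>] smooth_\<delta>] smooth_on_delta_deriv[OF U]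
      unfolding smooth_on_def
      by (intro allI Ck_on_add[OF U] Ck_on_bounded_linear[OF U bounded_linear_minus[OF bounded_linear_ident]])
        blast+
    then show ?thesis
      by (simp add: sym_op[abs_def])
  qed
  \<comment> \<open>The neighbourhood is a ball, whose convexity is what the Poincare lemma
    requires.\<close>
  have nonvanishing_nbhd: "\<exists>V. open V \<and> convex V \<and> p \<in> V \<and> V \<subseteq> U \<and> (\<forall>q\<in>V. f q \<noteq> 0)"
    if "smooth_on U f" "p \<in> U" "f p \<noteq> 0" for f :: "real^2 \<Rightarrow> real" and p
  proof -
    have "open (U \<inter> f -` (- {0}))"
      using smooth_on_imp_continuous_on[OF that(1)] U
      by (intro continuous_open_preimage) auto
    moreover have "p \<in> U \<inter> f -` (- {0})"
      using that by simp
    ultimately obtain e where "e > 0" "ball p e \<subseteq> U \<inter> f -` (- {0})"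
      using openE by blast
    then show ?thesis
      by (intro exI[of _ "ball p e"]) auto
  qed
  show "nontrivial_jacobi_field U \<phi> (\<lambda>p. \<delta> p *\<^sub>R coord_field 2 p)"
    unfolding nontrivial_jacobi_field_def
  proof
    show "jacobi_field U (ode_metric \<phi>) (ode_field \<phi>) (\<lambda>p. \<delta> p *\<^sub>R coord_field 2 p)"
      unfolding \<delta>_def
      by (rule jacobi_field_scaleR_vertical[OF U \<phi> _ smooth_on_delta_fun[OF U]
            has_real_derivative_delta_fun has_real_derivative_delta_deriv])
        (use assms in blast)
    show "\<not> trivial_on U \<phi> (\<lambda>p. \<delta> p *\<^sub>R coord_field 2 p)"
    proof
      assume "trivial_on U \<phi> (\<lambda>p. \<delta> p *\<^sub>R coord_field 2 p)"
      then obtain a b where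
        J: "\<And>p. p \<in> U \<Longrightarrow> \<delta> p *\<^sub>R coord_field 2 p = (a * p $ 1 + b) *\<^sub>R ode_field \<phi> p"
        unfolding trivial_on_def by blast
      \<comment> \<open>Comparing first coordinates gives \<open>a x + b = 0\<close>; the second
        coordinates then give \<delta> = 0.\<close>
      have zero: "\<delta> p = 0" if "p \<in> U" for p
        using J[OF that] by (simp add: vec_eq_iff forall_2)
      obtain p where p: "p \<in> U"
        using \<open>U \<noteq> {}\<close> by blast
      \<comment> \<open>As \<delta> vanishes on the open set \<open>U\<close>, so does its
        derivative, and a common zero of both forces \<open>c1 = c2 = 0\<close>.\<close>
      have "vf_deriv (ode_field \<phi>) \<delta> p = 0"
        by (rule vf_deriv_cong[OF has_derivative_const U p zero])
      then have "delta_deriv k c1 c2 (p $ 1) = 0"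
        by (simp add: vf_deriv_eq[OF d\<delta>])
      then show False
        using zero[OF p] delta_fun_eq_0_imp assms(7) unfolding \<delta>_def by blast
    qed
  qed
  {
    fix p assume sym0: "\<forall>p\<in>U. sym_op \<phi> \<delta> p = 0" and p: "p \<in> U" "\<delta> p \<noteq> 0"
    obtain V where V: "open V" "convex V" "p \<in> V" "V \<subseteq> U" "\<And>q. q \<in> V \<Longrightarrow> \<delta> q \<noteq> 0"
      using nonvanishing_nbhd[OF smooth_\<delta> p] by blast
    have "integrating_factor_on V \<phi> (\<lambda>q. inverse (\<delta> q))"
    proof (rule integrating_factor_onI[OF V(1,2) smooth_on_subset[OF \<phi> V(4)]])
      show "smooth_on V (\<lambda>q. inverse (\<delta> q))"
        using smooth_on_subset[OF smooth_\<delta> V(4)] V(5)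
        unfolding smooth_on_def by (auto intro!: Ck_on_inverse V(1))
    next
      fix q assume q: "q \<in> V"
      \<comment> \<open>With \<open>\<delta>' = \<phi>_u \<delta>\<close>, \<open>A(1/\<delta>) = -
        \<delta>' / \<delta>^2 = - \<phi>_u / \<delta>\<close>.\<close>
      then have "delta_deriv k c1 c2 (q $ 1) = partial 2 \<phi> q * \<delta> q"
        using sym0 V(4) sym_op by auto
      then show "vf_deriv (ode_field \<phi>) (\<lambda>q. inverse (\<delta> q)) q + partial 2 \<phi> q * inverse (\<delta> q) = 0"
        using V(5)[OF q] by (simp add: vf_deriv_eq[OF Deriv.has_derivative_inverse[OF _ d\<delta>]])
    qed (use V in simp)
    then show "\<exists>V. open V \<and> p \<in> V \<and> V \<subseteq> U \<and> integrating_factor_on V \<phi> (\<lambda>q. inverse (\<delta> q))"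
      using V by blast
  }
  {
    fix p assume p: "p \<in> U" "sym_op \<phi> \<delta> p \<noteq> 0"
    obtain V where V: "open V" "convex V" "p \<in> V" "V \<subseteq> U" "\<And>q. q \<in> V \<Longrightarrow> sym_op \<phi> \<delta> q \<noteq> 0"
      using nonvanishing_nbhd[OF smooth_sym p] by blast
    have "integrating_factor_on V \<phi> (sym_op \<phi> \<delta>)"
    proof (rule integrating_factor_onI[OF V(1,2) smooth_on_subset[OF \<phi> V(4)] smooth_on_subset[OF smooth_sym V(4)] V(5)])
      fix q assume "q \<in> V"
      then have q: "q \<in> U"
        using V(4) by blast
      have riccati: "partial 1 (partial 2 \<phi>) q + \<phi> q * partial 2 (partial 2 \<phi>) q
          = - k - (partial 2 \<phi> q)\<^sup>2"
        using gaussian_curvature_ode_metric[OF U \<phi> q] bspec[OF assms(6) q] by linarith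
      note db = has_derivative_partials[OF smooth_on_differentiable[OF smooth_on_partial[OF \<phi>] q], of 2]
      \<comment> \<open>This is \<open>\<delta>'' - A(\<phi>_u \<delta>)\<close> with
        \<open>\<delta>'' = - k \<delta>\<close>. After \<open>riccati\<close> is inserted, the
        terms in \<open>k\<close> cancel and
        \<open>- \<phi>_u (\<delta>' - \<phi>_u \<delta>)\<close> remains.\<close>
      have "vf_deriv (ode_field \<phi>) (sym_op \<phi> \<delta>) q = - k * \<delta> q
          - (partial 2 \<phi> q * delta_deriv k c1 c2 (q $ 1)
            + (partial 1 (partial 2 \<phi>) q + \<phi> q * partial 2 (partial 2 \<phi>) q) * \<delta> q)"
        unfolding sym_op[abs_def]
        by (subst vf_deriv_eq[OF has_derivative_diff[OF
                has_derivative_comp_nth[OF has_real_derivative_delta_deriv] has_derivative_mult[OF db d\<delta>]]])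
          (simp add: \<delta>_def mult.commute)
      then show "vf_deriv (ode_field \<phi>) (sym_op \<phi> \<delta>) q + partial 2 \<phi> q * sym_op \<phi> \<delta> q = 0"
        unfolding riccati sym_op by (simp add: power2_eq_square algebra_simps)
    qed
    then show "\<exists>V. open V \<and> p \<in> V \<and> V \<subseteq> U \<and> integrating_factor_on V \<phi> (sym_op \<phi> \<delta>)"
      using V by blast
  }
qed

end
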